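(* Let $i\neq j$ in $\{0,1,2,3\}$ and let $G\in\varepsilon_{ij}$ be a block (a 2-connected graph). Then $G$ contains a cycle of type $i$ and a cycle of type $j$ that intersect, i.e. whose common part is a path with at least one edge.
   Context: All graphs are finite, simple and connected. An Euler graph is a connected graph all of whose nodes have even degree. A cycle of length $n$ is of type $i$ if $n\equiv i\pmod 4$. For distinct $i,j\in\{0,1,2,3\}$, $\varepsilon_{ij}$ is the class of Euler graphs in which every cycle has length $\equiv i$ or $\equiv j\pmod 4$ and which contain at least one cycle of each of the types $i$ and $j$. Two cycles are said to intersect if their intersection is a path $P_t$ with $t>0$ edges. *)

theory Defs
  imports "Graph_Theory.Graph_Theory" "HOL-Number_Theory.Cong"
begin

text \<open>
  Finite simple graphs are the \<^locale>\<open>pair_graph\<close>s: an undirected edge is represented by its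
  two opposite arcs, so the degree of a vertex is its out-degree.
\<close>

definition euler_graph :: "'a pair_pre_digraph \<Rightarrow> bool" where
  "euler_graph G \<longleftrightarrow> pair_graph G \<and> Digraph_Component.connected (with_proj G) \<and>
     (\<forall>v \<in> pverts G. even (out_degree (with_proj G) v))"

text \<open>
  The library's notion of cycle is the one for digraphs, which admits \<open>a, b, a\<close>; the cycles of an
  undirected simple graph are those of length at least 3.
\<close>

definition graph_cycle :: "'a pair_pre_digraph \<Rightarrow> ('a \<times> 'a) awalk \<Rightarrow> bool" where
  "graph_cycle G c \<longleftrightarrow> pre_digraph.cycle (with_proj G) c \<and> 3 \<le> length c"

definition cycle_of_type :: "'a pair_pre_digraph \<Rightarrow> nat \<Rightarrow> ('a \<times> 'a) awalk \<Rightarrow> bool" where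
  "cycle_of_type G i c \<longleftrightarrow> graph_cycle G c \<and> [length c = i] (mod 4)"

definition euler_class :: "nat \<Rightarrow> nat \<Rightarrow> 'a pair_pre_digraph set" where
  "euler_class i j = {G. euler_graph G \<and>
     (\<forall>c. graph_cycle G c \<longrightarrow> cycle_of_type G i c \<or> cycle_of_type G j c) \<and>
     (\<exists>c. cycle_of_type G i c) \<and> (\<exists>c. cycle_of_type G j c)}"

definition two_connected :: "'a pair_pre_digraph \<Rightarrow> bool" where
  "two_connected G \<longleftrightarrow> pair_graph G \<and> 3 \<le> card (pverts G) \<and>
     Digraph_Component.connected (with_proj G) \<and>
     (\<forall>v \<in> pverts G. Digraph_Component.connected (pre_digraph.del_vert (with_proj G) v))"

text \<open>The undirected graph formed by the vertices and edges of a walk with at least one edge.\<close>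

definition walk_graph :: "('a \<times> 'a) awalk \<Rightarrow> 'a pair_pre_digraph" where
  "walk_graph p = \<lparr> pverts = fst ` set p \<union> snd ` set p, parcs = set p \<union> (set p)\<inverse> \<rparr>"

definition graph_inter ::
  "'a pair_pre_digraph \<Rightarrow> 'a pair_pre_digraph \<Rightarrow> 'a pair_pre_digraph" where
  "graph_inter G H = \<lparr> pverts = pverts G \<inter> pverts H, parcs = parcs G \<inter> parcs H \<rparr>"

definition cycles_intersect ::
  "'a pair_pre_digraph \<Rightarrow> ('a \<times> 'a) awalk \<Rightarrow> ('a \<times> 'a) awalk \<Rightarrow> bool" where
  "cycles_intersect G c d \<longleftrightarrow>
     (\<exists>u p v. pre_digraph.apath (with_proj G) u p v \<and> 0 < length p \<and>
        graph_inter (walk_graph c) (walk_graph d) = walk_graph p)"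

end

theory Submission
  imports Defs
begin

text \<open>
  Two cycles intersect in a path with an edge iff they are two of the three cycles of a theta graph.
  Suppose that no theta subgraph contains cycles of both types; then all cycles have the same type.
  First, exchanging a segment of a cycle for an ear preserves the type. Two cycles \<open>C\<close>, \<open>D\<close> with a
  common edge are of the same type: follow \<open>D\<close> beyond the common segment until it meets \<open>C\<close> again and
  let this ear replace a segment of \<open>C\<close>; the common segment grows until \<open>C\<close> and \<open>D\<close> form a theta
  graph or coincide. By 2-connectedness every edge at a vertex of \<open>C\<close> starts an ear of \<open>C\<close> or joins
  two vertices of \<open>C\<close>, hence lies on a cycle of the type of \<open>C\<close>; moving along edges, one reaches a
  cycle of this type that shares an edge with any prescribed cycle \<open>D\<close>.
\<close>

section \<open>Cycles and theta graphs as vertex lists\<close>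

definition vcycle :: "('a \<Rightarrow> 'a \<Rightarrow> bool) \<Rightarrow> 'a list \<Rightarrow> bool" where
  "vcycle E xs \<longleftrightarrow> distinct xs \<and> 3 \<le> length xs \<and> successively E xs \<and> E (last xs) (hd xs)"

text \<open>The lists \<open>p\<close>, \<open>q\<close>, \<open>r\<close> are the inner vertices of the three paths from \<open>a\<close> to \<open>b\<close>.\<close>

definition theta :: "('a \<Rightarrow> 'a \<Rightarrow> bool) \<Rightarrow> 'a \<Rightarrow> 'a \<Rightarrow> 'a list \<Rightarrow> 'a list \<Rightarrow> 'a list \<Rightarrow> bool" where
  "theta E a b p q r \<longleftrightarrow> distinct (a # b # p @ q @ r) \<and>
     (\<forall>s \<in> {p, q, r}. successively E (a # s @ [b])) \<and>
     (p \<noteq> [] \<or> q \<noteq> []) \<and> (p \<noteq> [] \<or> r \<noteq> []) \<and> (q \<noteq> [] \<or> r \<noteq> [])"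

lemma successively_rev_symmetric:
  assumes "\<And>x y. E x y \<Longrightarrow> E y x"
  shows "successively E (rev xs) \<longleftrightarrow> successively E xs"
proof -
  have "(\<lambda>x y. E y x) = E" using assms by blast
  then show ?thesis by (metis successively_rev)
qed

lemma successively_between_iff:
  "successively E (a # s @ [b]) \<longleftrightarrow>
     (if s = [] then E a b else E a (hd s) \<and> successively E s \<and> E (last s) b)"
  by (auto simp: successively_Cons successively_append_iff)

lemma vcycle_append_commute: "vcycle E (xs @ ys) \<Longrightarrow> vcycle E (ys @ xs)"
  by (cases "xs = []"; cases "ys = []") (auto simp: vcycle_def successively_append_iff)

text \<open>Two internally disjoint paths between \<open>a\<close> and \<open>b\<close>; the
  condition that \<open>p\<close> or \<open>q\<close> is nonempty is what length at least 3
  becomes.\<close>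

lemma vcycle_split_iff:
  "vcycle E (a # p @ b # q) \<longleftrightarrow> distinct (a # b # p @ q) \<and> (p \<noteq> [] \<or> q \<noteq> []) \<and>
     successively E (a # p @ [b]) \<and> successively E (b # q @ [a])"
  unfolding successively_between_iff
  by (cases p; cases q) (auto simp: vcycle_def successively_append_iff successively_Cons)

text \<open>Induction from the end of the walk: a vertex of \<open>A\<close> restarts the path, a
  repeated vertex cuts it short, any other is prepended. An empty \<open>r\<close> means that
  \<open>w\<close> itself lies in \<open>A\<close>.\<close>

lemma first_hit_path:
  assumes "(\<lambda>x y. E x y \<and> x \<noteq> c \<and> y \<noteq> c)\<^sup>*\<^sup>* w y" and "y \<in> A" and "c \<notin> A"
  shows "\<exists>r z. z \<in> A \<and> distinct r \<and> set r \<inter> A = {} \<and> c \<notin> set r \<and>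
    successively E (r @ [z]) \<and> hd (r @ [z]) = w"
  using assms(1)
proof (induction rule: converse_rtranclp_induct)
  case base
  show ?case using assms by (intro exI[of _ "[]"] exI[of _ y]) auto
next
  case (step w w')
  then obtain r z where IH: "z \<in> A" "distinct r" "set r \<inter> A = {}" "c \<notin> set r"
    "successively E (r @ [z])" "hd (r @ [z]) = w'" by blast
  consider "w \<in> A" | "w \<in> set r" | "w \<notin> A" "w \<notin> set r" by blast
  then show ?case
  proof cases
    case 1
    then show ?thesis by (intro exI[of _ "[]"] exI[of _ w]) auto
  next
    case 2
    then obtain r1 r2 where "r = r1 @ w # r2" by (auto simp: in_set_conv_decomp)
    then show ?thesis using IH
      by (intro exI[of _ "w # r2"] exI[of _ z]) (auto simp: successively_append_iff)
  next
    case 3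
    then show ?thesis using IH step.hyps
      by (intro exI[of _ "w # r"] exI[of _ z]) (auto simp: successively_Cons)
  qed
qed

section \<open>Cycles when no theta graph has two colours\<close>

text \<open>The type is abstracted to a function \<open>col\<close> of the length. Comparing two of
  the three cycles suffices, as \<open>theta\<close> is invariant under permuting \<open>p\<close>,
  \<open>q\<close>, \<open>r\<close>.\<close>

locale theta_monochromatic =
  fixes E :: "'a \<Rightarrow> 'a \<Rightarrow> bool" and col :: "nat \<Rightarrow> 'c"
  assumes sym: "E x y \<Longrightarrow> E y x"
    and theta_col: "theta E a b p q r \<Longrightarrow>
      col (length p + length q + 2) = col (length p + length r + 2)"
begin

lemmas successively_rev_sym = successively_rev_symmetric[of E, OF sym]

lemma vcycle_rev: "vcycle E xs \<Longrightarrow> vcycle E (rev xs)"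
  using sym by (auto simp: vcycle_def successively_rev_sym hd_rev last_rev simp del: successively_rev)

text \<open>Cycle and ear form a theta graph, and both cycles use its path through \<open>q\<close>.
  The last assumption keeps the new cycle from shrinking to a single edge.\<close>

lemma vcycle_exchange:
  assumes "vcycle E (a # p @ b # q)" and "successively E (a # r @ [b])" and "distinct r"
    and "set r \<inter> set (a # p @ b # q) = {}" and "r \<noteq> [] \<or> q \<noteq> []"
  shows "vcycle E (a # r @ b # q)"
    and "col (length (a # p @ b # q)) = col (length (a # r @ b # q))"
proof -
  show "vcycle E (a # r @ b # q)"
    using assms unfolding vcycle_split_iff by auto
  show "col (length (a # p @ b # q)) = col (length (a # r @ b # q))"
  \<comment> \<open>With both empty there is no theta graph, but the two cycles are the same
    list.\<close>
  proof (cases "p = [] \<and> r = []")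
    case False
    have "successively E (a # rev q @ [b])"
      using assms(1) successively_rev_sym[of "b # q @ [a]"]
      by (simp add: vcycle_split_iff del: successively_rev)
    then have "theta E a b (rev q) p r"
      using assms False unfolding theta_def vcycle_split_iff by auto
    from theta_col[OF this] show ?thesis by (simp add: add.commute)
  qed simp
qed

text \<open>Each exchange moves an initial part of \<open>D\<close> into the common segment
  \<open>S\<close>, so induction on the length of \<open>D\<close> applies. Two vertices in
  \<open>S\<close> mean a common edge.\<close>

lemma common_segment_same_col:
  assumes "vcycle E (S @ X)" and "vcycle E (S @ D)" and "2 \<le> length S"
  shows "col (length (S @ X)) = col (length (S @ D))"
  using assms
proof (induction "length D" arbitrary: S X D rule: less_induct)
  case less
  from less.prems(3) obtain s S1 t where S: "S = s # S1 @ [t]"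
    by (cases S; cases "tl S" rule: rev_cases) auto
  show ?case
  proof (cases "set D \<inter> set X = {}")
    case True
    have X: "vcycle E (t # X @ s # S1)"
      using vcycle_append_commute[of E "s # S1" "t # X"] less.prems(1) by (simp add: S)
    have D: "vcycle E (t # D @ s # S1)"
      using vcycle_append_commute[of E "s # S1" "t # D"] less.prems(2) by (simp add: S)
    have "col (length (t # X @ s # S1)) = col (length (t # D @ s # S1))"
      by (rule vcycle_exchange(2)[OF X]) (use D True in \<open>auto simp: vcycle_split_iff\<close>)
    then show ?thesis by (simp add: S add.commute)
  next
    case False
    then obtain T y D' where D: "D = T @ y # D'" "y \<in> set X" "set T \<inter> set X = {}"
      using split_list_first_prop[of D "\<lambda>y. y \<in> set X"] by blast
    then obtain U V where X: "X = U @ y # V" by (auto simp: in_set_conv_decomp)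
    let ?S0 = "s # S1"
    \<comment> \<open>Rotated to start at \<open>t\<close>, the cycle has \<open>T\<close> as an ear
      from \<open>t\<close> to \<open>y\<close>. The ear replaces \<open>U\<close>; the rest, which
      contains \<open>S\<close>, stays.\<close>
    have C: "vcycle E (t # U @ y # V @ ?S0)"
      using vcycle_append_commute[of E ?S0 "t # X"] less.prems(1) by (simp add: S X)
    have D_rot: "vcycle E (t # T @ y # D' @ ?S0)"
      using vcycle_append_commute[of E ?S0 "t # D"] less.prems(2) by (simp add: S D)
    have ear: "successively E (t # T @ [y])" "distinct T" "set T \<inter> set (t # U @ y # V @ ?S0) = {}"
      using D_rot D(3) unfolding vcycle_split_iff X by auto
    note C' = vcycle_exchange[OF C ear]
    have "vcycle E ((t # T @ y # V) @ ?S0)"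
      using C'(1) by simp
    from vcycle_append_commute[OF this]
    have "vcycle E ((S @ T @ [y]) @ V)"
      by (simp add: S)
    moreover have "vcycle E ((S @ T @ [y]) @ D')"
      using less.prems(2) by (simp add: D)
    ultimately have "col (length ((S @ T @ [y]) @ V)) = col (length ((S @ T @ [y]) @ D'))"
      using less.hyps[of D' "S @ T @ [y]" V] by (simp add: D S)
    then show ?thesis using C'(2) by (simp add: S X D add_ac)
  qed
qed

text \<open>Since deleting \<open>c\<close> does not disconnect the graph, the edge \<open>c w\<close> extends to an ear of the
  cycle, and the ear can replace one of the two segments of the cycle between its ends.\<close>

lemma same_col_cycle_through_edge:
  assumes C: "vcycle E C" "c \<in> set C" and cw: "E c w"
    and reach: "\<And>y. y \<in> set C \<Longrightarrow> y \<noteq> c \<Longrightarrow> (\<lambda>x y. E x y \<and> x \<noteq> c \<and> y \<noteq> c)\<^sup>*\<^sup>* w y"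
  shows "\<exists>Z. vcycle E (c # w # Z) \<and> col (length (c # w # Z)) = col (length C)"
proof -
  obtain C1 C2 where C12: "C = C1 @ c # C2" using C(2) by (auto simp: in_set_conv_decomp)
  let ?C0 = "C2 @ C1"
  have rot: "vcycle E (c # ?C0)"
    using vcycle_append_commute[of E C1 "c # C2"] C(1) C12 by simp
  then have c: "c \<notin> set ?C0" by (auto simp: vcycle_def)
  from rot obtain y where y: "y \<in> set ?C0" by (cases ?C0) (auto simp: vcycle_def)
  then have "(\<lambda>x y. E x y \<and> x \<noteq> c \<and> y \<noteq> c)\<^sup>*\<^sup>* w y"
    using c by (intro reach) (auto simp: C12)
  from first_hit_path[OF this y c] obtain r z where r: "z \<in> set ?C0" "distinct r"
    "set r \<inter> set ?C0 = {}" "c \<notin> set r" "successively E (r @ [z])" "hd (r @ [z]) = w"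
    by blast
  obtain U V where UV: "?C0 = U @ z # V" using r(1) by (metis in_set_conv_decomp)
  have cyc: "vcycle E (c # U @ z # V)" using rot UV by simp
  have len: "length (c # U @ z # V) = length C"
    using arg_cong[OF UV, of length] by (simp add: C12)
  show ?thesis
  \<comment> \<open>In the first case \<open>w\<close> is the last vertex of the cycle, so the edge
    \<open>c w\<close> already belongs to it and reversal puts \<open>w\<close> after
    \<open>c\<close>. Otherwise the ear replaces \<open>U\<close>.\<close>
  proof (cases "r = [] \<and> V = []")
    case True
    then have "w = z" using r(6) by simp
    have "vcycle E ((z # rev U) @ [c])"
      using vcycle_rev[OF cyc] True by simp
    from vcycle_append_commute[OF this] show ?thesis
      using True len \<open>w = z\<close> by (intro exI[of _ "rev U"]) simp
  next
    case False
    have "successively E (c # r @ [z])"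
      using r(5,6) cw by (cases r) auto
    then have ex: "vcycle E (c # r @ z # V)"
      "col (length (c # U @ z # V)) = col (length (c # r @ z # V))"
      using vcycle_exchange[OF cyc, of r] r False UV[symmetric] by auto
    have "\<exists>Z. r @ z # V = w # Z" using r(6) by (cases r) auto
    then show ?thesis using ex len by metis
  qed
qed

text \<open>A cycle of the colour of \<open>C\<close> is carried along a walk to a vertex of
  \<open>D\<close>, then made to share an edge with \<open>D\<close>.\<close>

lemma all_cycles_same_col:
  assumes loopfree: "\<And>x. \<not> E x x"
    and conn: "\<And>x y. x \<in> V \<Longrightarrow> y \<in> V \<Longrightarrow> E\<^sup>*\<^sup>* x y"
    and conn_del: "\<And>c x y. \<lbrakk>c \<in> V; x \<in> V; y \<in> V; x \<noteq> c; y \<noteq> c\<rbrakk> \<Longrightarrow>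
      (\<lambda>x y. E x y \<and> x \<noteq> c \<and> y \<noteq> c)\<^sup>*\<^sup>* x y"
    and verts: "\<And>x y. E x y \<Longrightarrow> x \<in> V"
    and C: "vcycle E C" and D: "vcycle E D"
  shows "col (length C) = col (length D)"
proof -
  have vcycle_verts: "set xs \<subseteq> V" if "vcycle E xs" for xs
  proof
    fix x assume "x \<in> set xs"
    then obtain ys zs where "xs = ys @ x # zs" by (auto simp: in_set_conv_decomp)
    \<comment> \<open>Rotation to start at \<open>x\<close> exhibits a neighbour of
      \<open>x\<close>.\<close>
    then have "vcycle E (x # zs @ ys)" using vcycle_append_commute that by fastforce
    then obtain y where "E x y" by (cases "zs @ ys") (auto simp: vcycle_def)
    then show "x \<in> V" by (rule verts)
  qed
  have through_edge: "\<exists>Z. vcycle E (x # y # Z) \<and> col (length (x # y # Z)) = col (length B)"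
    if "vcycle E B" "x \<in> set B" "E x y" for B x y
  proof (rule same_col_cycle_through_edge[OF that])
    have "y \<noteq> x" using that(3) loopfree by blast
    then show "(\<lambda>u v. E u v \<and> u \<noteq> x \<and> v \<noteq> x)\<^sup>*\<^sup>* y z" if "z \<in> set B" "z \<noteq> x" for z
      using conn_del vcycle_verts[OF \<open>vcycle E B\<close>] that \<open>x \<in> set B\<close> verts sym \<open>E x y\<close> by blast
  qed
  have through_vertex: "\<exists>B. vcycle E B \<and> v \<in> set B \<and> col (length B) = col (length C)"
    if "E\<^sup>*\<^sup>* (hd C) v" for v
    using that
  proof (induction rule: rtranclp_induct)
    case base
    show ?case using C hd_in_set[of C] by (fastforce simp: vcycle_def)
  next
    \<comment> \<open>The replacement cycle through the edge \<open>y z\<close> contains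
      \<open>z\<close>.\<close>
    case (step y z)
    then show ?case using through_edge[of _ y z] by (metis list.set_intros)
  qed
  obtain x y D' where D': "D = x # y # D'" "E x y"
    using D by (cases D; cases "tl D") (auto simp: vcycle_def)
  have "hd C \<in> set C" using C by (intro hd_in_set) (auto simp: vcycle_def)
  then have "E\<^sup>*\<^sup>* (hd C) x"
    using vcycle_verts[OF C] vcycle_verts[OF D] D'(1) by (intro conn) auto
  then obtain B where B: "vcycle E B" "x \<in> set B" "col (length B) = col (length C)"
    using through_vertex by blast
  with through_edge[OF B(1,2) D'(2)] obtain Z where
    Z: "vcycle E ([x, y] @ Z)" "col (length ([x, y] @ Z)) = col (length C)" by auto
  then show ?thesis
    using common_segment_same_col[OF Z(1), of D'] D D'(1) by simp
qed

end

section \<open>From vertex lists to walks in pair graphs\<close>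

abbreviation arc_rel :: "'a pair_pre_digraph \<Rightarrow> 'a \<Rightarrow> 'a \<Rightarrow> bool" where
  "arc_rel G \<equiv> \<lambda>x y. (x, y) \<in> parcs G"

definition edges_of :: "'a list \<Rightarrow> ('a \<times> 'a) set" where
  "edges_of xs = set (vwalk_arcs xs) \<union> (set (vwalk_arcs xs))\<inverse>"

lemma edges_of_append: "edges_of (xs @ y # zs) = edges_of (xs @ [y]) \<union> edges_of (y # zs)"
  by (induction xs rule: vwalk_arcs.induct) (auto simp: edges_of_def)

lemma edges_of_rev: "edges_of (rev xs) = edges_of xs"
  by (auto simp: edges_of_def set_vwalk_arcs_rev)

lemma edges_of_subset: "edges_of xs \<subseteq> set xs \<times> set xs"
  by (auto simp: edges_of_def dest: arcs_in_vwalk_arcs)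

text \<open>If \<open>q\<close> is nonempty, every edge of the path has an end in
  \<open>q\<close>.\<close>

lemma edge_between_ends:
  assumes "distinct (a # q @ [b])" "(x, y) \<in> edges_of (a # q @ [b])" "x \<in> {a, b}" "y \<in> {a, b}"
  shows "q = []"
proof (rule ccontr)
  assume "q \<noteq> []"
  then have "set (vwalk_arcs (a # q @ [b])) = insert (a, hd q) (insert (last q, b) (set (vwalk_arcs q)))"
    by (auto simp: vwalk_arcs_append)
  then show False
    using assms \<open>q \<noteq> []\<close> hd_in_set[of q] last_in_set[of q] arcs_in_vwalk_arcs[of _ q]
    by (fastforce simp: edges_of_def)
qed

lemma length_vwalk_arcs: "length (vwalk_arcs xs) = length xs - 1"
  by (induction xs rule: vwalk_arcs.induct) auto

lemma walk_graph_vwalk_arcs: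
  assumes "2 \<le> length xs"
  shows "walk_graph (vwalk_arcs xs) = \<lparr> pverts = set xs, parcs = edges_of xs \<rparr>"
proof -
  have "fst ` set (vwalk_arcs xs) \<union> snd ` set (vwalk_arcs xs) = set xs"
    using assms
  proof (induction xs rule: vwalk_arcs.induct)
    case (3 x y xs)
    then show ?case by (cases xs) auto
  qed auto
  then show ?thesis by (simp add: walk_graph_def edges_of_def)
qed

text \<open>An edge common to the paths through \<open>q\<close> and \<open>r\<close> would join
  \<open>a\<close> and \<open>b\<close>. Both paths would then be that single edge, which
  \<open>theta\<close> excludes.\<close>

lemma graph_inter_theta_cycles:
  assumes "theta E a b p q r"
  shows "graph_inter (walk_graph (vwalk_arcs (a # p @ b # rev q @ [a])))
           (walk_graph (vwalk_arcs (a # p @ b # rev r @ [a]))) = walk_graph (vwalk_arcs (a # p @ [b]))"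
proof -
  have edges: "edges_of (a # p @ b # rev s @ [a]) = edges_of (a # p @ [b]) \<union> edges_of (a # s @ [b])" for s
    using edges_of_append[of "a # p" b "rev s @ [a]"] edges_of_rev[of "a # s @ [b]"] by simp
  have "edges_of (a # q @ [b]) \<inter> edges_of (a # r @ [b]) = {}"
  proof (rule ccontr)
    assume "\<not> ?thesis"
    then obtain x y where xy: "(x, y) \<in> edges_of (a # q @ [b])" "(x, y) \<in> edges_of (a # r @ [b])"
      by auto
    have "x \<in> set (a # q @ [b]) \<inter> set (a # r @ [b])" "y \<in> set (a # q @ [b]) \<inter> set (a # r @ [b])"
      using xy subsetD[OF edges_of_subset] by blast+
    then have ends: "x \<in> {a, b}" "y \<in> {a, b}"
      using assms unfolding theta_def by auto
    have "distinct (a # q @ [b])" "distinct (a # r @ [b])"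
      using assms unfolding theta_def by auto
    then have "q = []" "r = []"
      using edge_between_ends[OF _ xy(1) ends] edge_between_ends[OF _ xy(2) ends] by blast+
    then show False using assms by (simp add: theta_def)
  qed
  moreover have "set q \<inter> set r = {}" using assms by (auto simp: theta_def)
  ultimately show ?thesis
    unfolding graph_inter_def
    by (subst (1 2 3 4 5) walk_graph_vwalk_arcs) (auto simp: edges simp del: vwalk_arcs_Cons)
qed

lemma pcas_vwalk_arcs: "xs \<noteq> [] \<Longrightarrow> pcas (hd xs) (vwalk_arcs xs) (last xs)"
  by (induction xs rule: vwalk_arcs.induct) auto

lemma pawalk_verts_vwalk_arcs: "xs \<noteq> [] \<Longrightarrow> pawalk_verts (hd xs) (vwalk_arcs xs) = xs"
  by (induction xs rule: vwalk_arcs.induct) auto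

lemma set_vwalk_arcs_subset_iff: "set (vwalk_arcs xs) \<subseteq> parcs G \<longleftrightarrow> successively (arc_rel G) xs"
  by (induction xs rule: vwalk_arcs.induct) auto

context pair_graph begin

lemma awalk_vwalk_arcs:
  assumes "successively (arc_rel G) xs" and "2 \<le> length xs"
  shows "awalk (hd xs) (vwalk_arcs xs) (last xs)"
proof -
  have "hd xs \<in> pverts G" using assms by (cases xs; cases "tl xs") (auto dest: in_arcsD1)
  then show ?thesis
    using assms pcas_vwalk_arcs[of xs] by (cases xs) (auto simp: awalk_def set_vwalk_arcs_subset_iff)
qed

lemma graph_cycle_vwalk_arcs:
  assumes "vcycle (arc_rel G) xs"
  shows "graph_cycle G (vwalk_arcs (xs @ [hd xs]))"
proof -
  let ?ys = "xs @ [hd xs]"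
  have "awalk (hd ?ys) (vwalk_arcs ?ys) (last ?ys)"
    using assms by (intro awalk_vwalk_arcs) (auto simp: vcycle_def successively_append_iff)
  moreover have "pawalk_verts (hd ?ys) (vwalk_arcs ?ys) = ?ys"
    by (intro pawalk_verts_vwalk_arcs) simp
  moreover have "length (vwalk_arcs ?ys) = length xs"
    by (simp add: length_vwalk_arcs)
  ultimately show ?thesis
    using assms unfolding graph_cycle_def cycle_def vcycle_def
    by (cases xs) auto
qed

lemma successively_pawalk_verts:
  "awalk u p v \<Longrightarrow> successively (arc_rel G) (pawalk_verts u p)"
  by (induction p arbitrary: u) (auto simp: awalk_simps successively_Cons awalk_verts_conv)

lemma graph_cycle_vcycle:
  assumes "graph_cycle G c"
  shows "\<exists>xs. vcycle (arc_rel G) xs \<and> length xs = length c"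
proof -
  obtain u where u: "awalk u c u" "distinct (tl (pawalk_verts u c))" "3 \<le> length c"
    using assms unfolding graph_cycle_def cycle_def by auto
  then obtain e c' where c: "c = e # c'" by (cases c) auto
  \<comment> \<open>Dropping the first arc leaves each vertex once, with \<open>u\<close> at the
    end.\<close>
  let ?xs = "pawalk_verts (snd e) c'"
  have "awalk (snd e) c' u" "e \<in> parcs G" "fst e = u" using u(1) by (auto simp: c awalk_simps)
  then have "vcycle (arc_rel G) ?xs"
    using u successively_pawalk_verts[of "snd e" c' u] length_awalk_verts[of "snd e" c']
    by (auto simp: vcycle_def c elim!: awalkE)
  then show ?thesis using length_awalk_verts[of "snd e" c'] by (auto simp: c)
qed

text \<open>Connectedness is strong connectedness of the symmetric closure, which adds no arcs to a
  pair graph.\<close>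

lemma connected_imp_rtranclp:
  assumes "Digraph_Component.connected (with_proj G)" "x \<in> pverts G" "y \<in> pverts G"
  shows "(arc_rel G)\<^sup>*\<^sup>* x y"
proof -
  have "x \<rightarrow>\<^sup>*\<^bsub>mk_symmetric (with_proj G)\<^esub> y"
    using assms by (auto simp: connected_def strongly_connected_def)
  then have "(x, y) \<in> (parcs (mk_symmetric (with_proj G)))\<^sup>*"
    unfolding reachable_def by (auto intro: rtrancl_on_rtranclI)
  moreover have "parcs (mk_symmetric (with_proj G)) \<subseteq> parcs G"
    by (auto simp: parcs_mk_symmetric intro: arcs_symmetric)
  ultimately have "(x, y) \<in> (parcs G)\<^sup>*"
    using rtrancl_mono by blast
  then show ?thesis by (simp add: rtranclp_rtrancl_eq)
qed

lemma connected_del_vert_imp_rtranclp: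
  assumes "Digraph_Component.connected (del_vert c)" "x \<in> pverts G" "y \<in> pverts G" "x \<noteq> c" "y \<noteq> c"
  shows "(\<lambda>u v. (u, v) \<in> parcs G \<and> u \<noteq> c \<and> v \<noteq> c)\<^sup>*\<^sup>* x y"
proof -
  have "x \<rightarrow>\<^sup>*\<^bsub>mk_symmetric (del_vert c)\<^esub> y"
    using assms by (auto simp: connected_def strongly_connected_def verts_del_vert)
  then have "(x, y) \<in> (parcs (mk_symmetric (del_vert c)))\<^sup>*"
    unfolding reachable_def by (auto intro: rtrancl_on_rtranclI)
  moreover have "parcs (mk_symmetric (del_vert c)) \<subseteq> {(u, v). (u, v) \<in> parcs G \<and> u \<noteq> c \<and> v \<noteq> c}"
    by (auto simp: parcs_mk_symmetric del_vert_simps intro: arcs_symmetric)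
  ultimately have "(x, y) \<in> {(u, v). (u, v) \<in> parcs G \<and> u \<noteq> c \<and> v \<noteq> c}\<^sup>*"
    using rtrancl_mono by blast
  then show ?thesis by (simp add: rtranclp_rtrancl_eq)
qed

text \<open>Both cycles run through \<open>p\<close> and return along \<open>q\<close> or
  \<open>r\<close>. Their common path has an edge even if \<open>p\<close> is empty.\<close>

lemma theta_cycles_intersect:
  assumes "theta (arc_rel G) a b p q r"
  shows "\<exists>c d. graph_cycle G c \<and> graph_cycle G d \<and> length c = length p + length q + 2 \<and>
    length d = length p + length r + 2 \<and> cycles_intersect G c d"
proof -
  have sym: "successively (arc_rel G) (rev xs) \<longleftrightarrow> successively (arc_rel G) xs" for xs
    by (rule successively_rev_symmetric) (rule arcs_symmetric)
  have cyc: "vcycle (arc_rel G) (a # p @ b # rev s)"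
    if "s \<in> {q, r}" for s
  proof -
    have "successively (arc_rel G) (a # s @ [b])"
      using assms that unfolding theta_def by blast
    then have "successively (arc_rel G) (rev (a # s @ [b]))"
      by (simp only: sym)
    then have "successively (arc_rel G) (b # rev s @ [a])"
      by (simp only: rev.simps rev_append append.simps append_assoc)
    then show ?thesis
      using assms that unfolding theta_def vcycle_split_iff by auto
  qed
  let ?c = "\<lambda>s. vwalk_arcs (a # p @ b # rev s @ [a])"
  have len: "length (?c s) = length p + length s + 2" for s
    by (simp add: length_vwalk_arcs)
  have gc: "graph_cycle G (?c s)" if "s \<in> {q, r}" for s
    using graph_cycle_vwalk_arcs[OF cyc[OF that]] by simp
  let ?p = "a # p @ [b]"
  have "apath (hd ?p) (vwalk_arcs ?p) (last ?p)"
    using assms awalk_vwalk_arcs[of ?p] pawalk_verts_vwalk_arcs[of ?p]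
    by (auto simp: apath_def theta_def)
  moreover have "0 < length (vwalk_arcs ?p)" by simp
  ultimately have "cycles_intersect G (?c q) (?c r)"
    unfolding cycles_intersect_def using graph_inter_theta_cycles[OF assms] by blast
  then show ?thesis using gc[of q] gc[of r] len by blast
qed

end

section \<open>Contradiction from the absence of an intersecting pair of different types\<close>

theorem theorem2:
  fixes G :: "'a pair_pre_digraph" and i j :: nat
  assumes "i \<in> {0, 1, 2, 3}" and "j \<in> {0, 1, 2, 3}" and "i \<noteq> j"
    and "G \<in> euler_class i j" and "two_connected G"
  shows "\<exists>c d. cycle_of_type G i c \<and> cycle_of_type G j d \<and> cycles_intersect G c d"
proof (rule ccontr)
  assume no_pair: "\<not> ?thesis"
  interpret pair_graph G using assms(5) by (simp add: two_connected_def)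
  have cycles_intersect_commute: "cycles_intersect G d c" if "cycles_intersect G c d" for c d
    using that by (simp add: cycles_intersect_def graph_inter_def Int_commute)
  \<comment> \<open>Turns the congruences defining the types into equations for
    \<open>length c mod 4\<close>.\<close>
  have ij: "i mod 4 = i" "j mod 4 = j" using assms(1,2) by auto
  have types: "cycle_of_type G i c \<or> cycle_of_type G j c" if "graph_cycle G c" for c
    using assms(4) that by (auto simp: euler_class_def)
  interpret theta_monochromatic "arc_rel G" "\<lambda>n. n mod 4"
  proof
    fix a b p q r
    assume "theta (arc_rel G) a b p q r"
    from theta_cycles_intersect[OF this] obtain c d where cd: "graph_cycle G c" "graph_cycle G d"
      "length c = length p + length q + 2" "length d = length p + length r + 2"
      "cycles_intersect G c d" by blast
    \<comment> \<open>Different residues would make one cycle of type \<open>i\<close> and the other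
      of type \<open>j\<close>, in either order; hence the symmetry of
      \<open>cycles_intersect\<close>.\<close>
    then have "length c mod 4 = length d mod 4"
      using types[OF cd(1)] types[OF cd(2)] no_pair cycles_intersect_commute
      unfolding cycle_of_type_def cong_def by metis
    then show "(length p + length q + 2) mod 4 = (length p + length r + 2) mod 4"
      using cd by simp
  qed (use arcs_symmetric in blast)
  obtain c d where "cycle_of_type G i c" "cycle_of_type G j d"
    using assms(4) by (auto simp: euler_class_def)
  then obtain xs ys where xs: "vcycle (arc_rel G) xs" "length xs mod 4 = i"
    and ys: "vcycle (arc_rel G) ys" "length ys mod 4 = j"
    using graph_cycle_vcycle[of c] graph_cycle_vcycle[of d] ij
    unfolding cycle_of_type_def cong_def by metis
  have "length xs mod 4 = length ys mod 4"
  proof (rule all_cycles_same_col[where V = "pverts G", OF _ _ _ _ xs(1) ys(1)])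
    show "(x, x) \<notin> parcs G" for x using pair_no_loops by fastforce
    show "(arc_rel G)\<^sup>*\<^sup>* x y" if "x \<in> pverts G" "y \<in> pverts G" for x y
      using connected_imp_rtranclp assms(5) that by (auto simp: two_connected_def)
    show "(\<lambda>u v. (u, v) \<in> parcs G \<and> u \<noteq> v' \<and> v \<noteq> v')\<^sup>*\<^sup>* x y"
      if "v' \<in> pverts G" "x \<in> pverts G" "y \<in> pverts G" "x \<noteq> v'" "y \<noteq> v'" for v' x y
      using connected_del_vert_imp_rtranclp assms(5) that by (auto simp: two_connected_def)
  qed (auto dest: in_arcsD1)
  then show False using xs ys assms(3) by simp
qed

end
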